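(* Let $n \geq 1$, let $\mathbb{F}_q$ be a finite field with $q = p^m$ elements ($p$ prime, $m \geq 1$), let $1 \leq i \leq n$, let $a_i \in \mathbb{F}_q[X_1,\ldots,X_{i-1},X_{i+1},\ldots,X_n]$, and let $$E_{a_i}^{(q)} = (X_1,\ldots,X_{i-1},X_i + a_i,X_{i+1},\ldots,X_n)$$ be the corresponding elementary automorphism over $\mathbb{F}_q$. If $q$ is odd, or $q = 2^m$ with $m \geq 2$, then $\pi_q(E_{a_i}^{(q)}) \in \mathrm{Alt}(\mathbb{F}_q^n)$, i.e. $\mathrm{sgn}(\pi_q(E_{a_i}^{(q)})) = 1$. If $q = 2$, then $\mathrm{sgn}(\pi_q(E_{a_i}^{(q)}))$ depends only on the number $M_{a_i}$ of monomials of the form $cX_1^{e_1}\cdots X_{i-1}^{e_{i-1}}X_{i+1}^{e_{i+1}}\cdots X_n^{e_n}$ with $c \in \mathbb{F}_q^*$ and $e_j \geq 1$ for all $j \in \{1,\ldots,n\}\setminus\{i\}$ appearing in the polynomial $a_i$; more precisely, $$\mathrm{sgn}(\pi_q(E_{a_i}^{(q)})) = (-1)^{M_{a_i}}.$$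
   Context: A polynomial map over a field $k$ is an $n$-tuple $F=(f_1,\ldots,f_n)$ with $f_i \in k[X_1,\ldots,X_n]$; it induces the map $k^n \to k^n$, $(x_1,\ldots,x_n) \mapsto (f_1(x_1,\ldots,x_n),\ldots,f_n(x_1,\ldots,x_n))$. A polynomial automorphism is a polynomial map that is invertible under composition of polynomial maps; $\mathrm{GA}_n(k)$ is the group of these. For $k=\mathbb{F}_q$, $\pi_q : \mathrm{GA}_n(\mathbb{F}_q) \to \mathrm{Sym}(\mathbb{F}_q^n)$ is the group homomorphism sending a polynomial automorphism to the permutation of $\mathbb{F}_q^n$ it induces. $\mathrm{Sym}(S)$ and $\mathrm{Alt}(S)$ are the symmetric and alternating groups on a finite set $S$, and $\mathrm{sgn} : \mathrm{Sym}(S) \to \{\pm 1\}$ is the sign homomorphism. The monomials appearing in $a_i$ are those occurring with nonzero coefficient in $a_i$ as a formal polynomial (no reduction modulo $X_j^q - X_j$). *)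

theory Defs
  imports
    "HOL-Computational_Algebra.Primes"
    "HOL-Library.Poly_Mapping"
    "HOL-Analysis.Finite_Cartesian_Product"
    "HOL-Combinatorics.Permutations"
begin

text \<open>
  Polynomials over \<open>'k\<close> in indeterminates indexed by the finite type \<open>'n\<close> are finitely supported
  maps from exponent vectors to coefficients, with the convolution product of
  \<^theory>\<open>HOL-Library.Poly_Mapping\<close>.  They are formal polynomials: no reduction modulo
  $X_j^q - X_j$ takes place.
\<close>

type_synonym ('n, 'k) mpoly = "('n \<Rightarrow>\<^sub>0 nat) \<Rightarrow>\<^sub>0 'k"

definition Var :: "'n \<Rightarrow> ('n, 'k::zero_neq_one) mpoly" where
  "Var j = Poly_Mapping.single (Poly_Mapping.single j 1) 1"

definition Const :: "'k \<Rightarrow> ('n, 'k::zero) mpoly" where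
  "Const c = Poly_Mapping.single 0 c"

definition polys_in :: "'n set \<Rightarrow> ('n, 'k::zero) mpoly set" where
  "polys_in J = {p. \<forall>e \<in> Poly_Mapping.keys p. Poly_Mapping.keys e \<subseteq> J}"

text \<open>
  Evaluation at \<open>x\<close>, the coefficients being mapped by \<open>h\<close>: the identity \<open>h\<close> gives the value at a
  point, and \<open>h = Const\<close> gives the substitution of polynomials for the indeterminates.
\<close>

definition mpoly_eval :: "('k::zero \<Rightarrow> 'r::comm_semiring_1) \<Rightarrow> ('n::finite \<Rightarrow> 'r) \<Rightarrow> ('n, 'k) mpoly \<Rightarrow> 'r" where
  "mpoly_eval h x p =
     (\<Sum>e \<in> Poly_Mapping.keys p. h (Poly_Mapping.lookup p e) * (\<Prod>j\<in>UNIV. x j ^ Poly_Mapping.lookup e j))"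

type_synonym ('n, 'k) poly_map = "'n \<Rightarrow> ('n, 'k) mpoly"

definition poly_map_comp ::
    "('n::finite, 'k::comm_ring_1) poly_map \<Rightarrow> ('n, 'k) poly_map \<Rightarrow> ('n, 'k) poly_map" where
  "poly_map_comp F G = (\<lambda>j. mpoly_eval Const G (F j))"

definition GA :: "('n::finite, 'k::comm_ring_1) poly_map set" where
  "GA = {F. \<exists>G. poly_map_comp F G = Var \<and> poly_map_comp G F = Var}"

definition induced_map :: "('n::finite, 'k::comm_ring_1) poly_map \<Rightarrow> 'k ^ 'n \<Rightarrow> 'k ^ 'n" where
  "induced_map F = (\<lambda>x. \<chi> j. mpoly_eval id (($) x) (F j))"

definition elementary :: "'n \<Rightarrow> ('n, 'k::comm_ring_1) mpoly \<Rightarrow> ('n, 'k) poly_map" where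
  "elementary i a = Var(i := Var i + a)"

definition Alt :: "'a set \<Rightarrow> ('a \<Rightarrow> 'a) set" where
  "Alt S = {f. f permutes S \<and> evenperm f}"

definition full_monomial_count :: "'n \<Rightarrow> ('n, 'k::zero) mpoly \<Rightarrow> nat" where
  "full_monomial_count i a =
     card {e \<in> Poly_Mapping.keys a. Poly_Mapping.lookup e i = 0 \<and> (\<forall>j. j \<noteq> i \<longrightarrow> Poly_Mapping.lookup e j \<ge> 1)}"


subsection \<open>Elementary maps are automorphisms and induce permutations\<close>

lemma Const_simps: "Const 0 = 0" "Const 1 = 1" "Const (c + d) = Const c + Const d"
  by (simp_all add: Const_def single_add)

lemma mpoly_eval_superset:
  assumes "h 0 = 0" "finite A" "Poly_Mapping.keys p \<subseteq> A"
  shows "mpoly_eval h x p =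
    (\<Sum>e \<in> A. h (Poly_Mapping.lookup p e) * (\<Prod>j\<in>UNIV. x j ^ Poly_Mapping.lookup e j))"
  unfolding mpoly_eval_def
  by (rule sum.mono_neutral_left) (use assms in \<open>auto simp: in_keys_iff\<close>)

lemma mpoly_eval_add:
  assumes "h 0 = 0" "\<And>c d. h (c + d) = h c + h d"
  shows "mpoly_eval h x (p + q) = mpoly_eval h x p + mpoly_eval h x q"
proof -
  let ?A = "Poly_Mapping.keys p \<union> Poly_Mapping.keys q"
  have "Poly_Mapping.keys (p + q) \<subseteq> ?A"
    by (rule Poly_Mapping.keys_add)
  then show ?thesis
    using assms(1)
    by (simp add: mpoly_eval_superset[of h ?A] lookup_add assms(2) algebra_simps sum.distrib)
qed

lemma mpoly_eval_Var:
  assumes "h 1 = 1"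
  shows "mpoly_eval h x (Var i) = x i"
proof -
  have "(\<Prod>j\<in>UNIV. x j ^ Poly_Mapping.lookup (Poly_Mapping.single i 1) j)
      = (\<Prod>j\<in>UNIV. if j = i then x j else 1)"
    by (rule prod.cong) (auto simp: lookup_single when_def)
  then show ?thesis
    using assms by (simp add: mpoly_eval_def Var_def)
qed

lemma mpoly_eval_cong:
  assumes "p \<in> polys_in J" "\<And>j. j \<in> J \<Longrightarrow> x j = y j"
  shows "mpoly_eval h x p = mpoly_eval h y p"
  unfolding mpoly_eval_def
proof (rule sum.cong, goal_cases)
  case (2 e)
  then have "x j ^ Poly_Mapping.lookup e j = y j ^ Poly_Mapping.lookup e j" for j
  proof (cases "j \<in> J")
    case False
    with 2 assms(1) have "Poly_Mapping.lookup e j = 0"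
      unfolding polys_in_def by (auto simp flip: not_in_keys_iff_lookup_eq_zero)
    then show ?thesis by simp
  qed (simp add: assms(2))
  then show ?case by simp
qed simp

lemma Var_power: "Var j ^ k = Poly_Mapping.single (Poly_Mapping.single j k) 1"
  by (induction k) (simp_all add: Var_def mult_single flip: single_add)

lemma prod_Var: 
  assumes "finite A"
  shows "(\<Prod>j\<in>A. (Var j :: ('n::finite, 'k::comm_ring_1) mpoly) ^ Poly_Mapping.lookup e j)
    = Poly_Mapping.single (\<Sum>j\<in>A. Poly_Mapping.single j (Poly_Mapping.lookup e j)) 1"
  using assms by (induction A rule: finite_induct) (simp_all add: Var_power mult_single)

lemma mpoly_eval_Const_Var: "mpoly_eval Const Var p = (p :: ('n::finite, 'k::comm_ring_1) mpoly)"
proof -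
  have e: "(\<Sum>j\<in>UNIV. Poly_Mapping.single j (Poly_Mapping.lookup e j)) = e" for e :: "'n \<Rightarrow>\<^sub>0 nat"
    by (rule poly_mapping_eqI) (simp add: lookup_sum lookup_single when_def)
  have "mpoly_eval Const Var p
      = (\<Sum>e\<in>Poly_Mapping.keys p. Poly_Mapping.single e (Poly_Mapping.lookup p e))"
    by (simp add: mpoly_eval_def prod_Var e Const_def mult_single)
  also have "\<dots> = p"
    by (rule poly_mapping_eqI) (auto simp: lookup_sum lookup_single when_def in_keys_iff)
  finally show ?thesis .
qed

lemma elementary_comp:
  assumes "b \<in> polys_in (UNIV - {i})"
  shows "poly_map_comp (elementary i b) (elementary i a) = elementary i (a + b)"
proof
  fix j
  have "mpoly_eval Const (elementary i a) b = mpoly_eval Const Var b"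
    by (rule mpoly_eval_cong[OF assms]) (simp add: elementary_def)
  then show "poly_map_comp (elementary i b) (elementary i a) j = elementary i (a + b) j"
    by (simp add: poly_map_comp_def elementary_def mpoly_eval_add mpoly_eval_Var
        mpoly_eval_Const_Var Const_simps add.assoc)
qed

lemma elementary_in_GA:
  assumes "a \<in> polys_in (UNIV - {i})"
  shows "elementary i a \<in> GA"
proof -
  have "- a \<in> polys_in (UNIV - {i})"
    using assms by (auto simp: polys_in_def in_keys_iff)
  then have "poly_map_comp (elementary i a) (elementary i (- a)) = Var"
    "poly_map_comp (elementary i (- a)) (elementary i a) = Var"
    using assms by (simp_all add: elementary_comp) (simp_all add: elementary_def)
  then show ?thesis
    unfolding GA_def by blast
qed

lemma induced_map_elementary:
  "induced_map (elementary i a) x =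
    (\<chi> j. if j = i then x $ i + mpoly_eval id (($) x) a else x $ j)"
  by (simp add: induced_map_def elementary_def vec_eq_iff mpoly_eval_add mpoly_eval_Var)

lemma induced_map_elementary_permutes:
  fixes a :: "('n::finite, 'k::{field, finite}) mpoly"
  assumes "a \<in> polys_in (UNIV - {i})"
  shows "induced_map (elementary i a) permutes UNIV"
proof -
  have "inj (induced_map (elementary i a))"
  proof (rule injI)
    fix x y assume eq: "induced_map (elementary i a) x = induced_map (elementary i a) y"
    then have ne: "x $ j = y $ j" if "j \<noteq> i" for j
      using that by (auto simp: induced_map_elementary vec_eq_iff dest: spec[of _ j])
    then have "mpoly_eval id (($) x) a = mpoly_eval id (($) y) a"
      by (intro mpoly_eval_cong[OF assms]) auto
    with eq have "x $ i = y $ i"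
      by (auto simp: induced_map_elementary vec_eq_iff dest: spec[of _ i])
    with ne show "x = y"
      by (metis vec_eq_iff)
  qed
  then show ?thesis
    by (intro bij_imp_permutes bijI finite_UNIV_inj_surj finite_class.finite_UNIV UNIV_I) auto
qed

end

theory Submission
  imports Defs
begin

text \<open>
  The sign is multiplicative in the shear term \<open>g\<close> of \<open>x \<mapsto> x + g(x) e\<^sub>i\<close>, and it is invariant
  under conjugation.  Rescaling the \<open>i\<close>-th coordinate conjugates \<open>g\<close> into \<open>c g\<close>, so if \<open>c\<close> and
  \<open>1 + c\<close> are both nonzero, which is possible as soon as \<open>q > 2\<close>, the sign is equal to its own
  square.  For \<open>q = 2\<close> it suffices to treat monomials.  If a variable \<open>X\<^sub>j\<close> with \<open>j \<noteq> i\<close> is missing from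
  \<open>g\<close>, then \<open>g = g X\<^sub>j + g (1 + X\<^sub>j)\<close>, and \<open>X\<^sub>j \<mapsto> X\<^sub>j + 1\<close> conjugates the two summands into
  each other.  If none is missing, the permutation is a transposition.
\<close>

section \<open>Shears by arbitrary functions and their signs\<close>

definition shear :: "'n \<Rightarrow> ('k ^ 'n \<Rightarrow> 'k) \<Rightarrow> 'k ^ 'n \<Rightarrow> ('k::comm_ring_1) ^ 'n::finite" where
  "shear i g x = (\<chi> j. if j = i then x $ i + g x else x $ j)"

text \<open>Independence is a property of functions, so that products such as
  \<open>g x * (1 + x $ j)\<close> can be treated without forming polynomials. For polynomials in
  \<open>polys_in (UNIV - {i})\<close> it follows from \<open>mpoly_eval_cong\<close>.\<close>

definition indep_of :: "'n \<Rightarrow> ('k ^ 'n::finite \<Rightarrow> 'b) \<Rightarrow> bool" where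
  "indep_of i g \<longleftrightarrow> (\<forall>x y. (\<forall>j. j \<noteq> i \<longrightarrow> x $ j = y $ j) \<longrightarrow> g x = g y)"

lemma shear_nth: "shear i g x $ j = (if j = i then x $ i + g x else x $ j)"
  by (simp add: shear_def)

lemma indep_ofD: "indep_of i g \<Longrightarrow> (\<And>j. j \<noteq> i \<Longrightarrow> x $ j = y $ j) \<Longrightarrow> g x = g y"
  unfolding indep_of_def by blast

lemma indep_of_shear: "indep_of i g \<Longrightarrow> g (shear i h x) = g x"
  by (erule indep_ofD) (simp add: shear_nth)

lemma indep_of_sum: "(\<And>e. e \<in> A \<Longrightarrow> indep_of i (f e)) \<Longrightarrow> indep_of i (\<lambda>x. \<Sum>e\<in>A. f e x)"
  unfolding indep_of_def by (intro allI impI sum.cong) blast+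

text \<open>In the composition \<open>g\<close> is evaluated after \<open>shear i h\<close> has
  moved the \<open>i\<close>-th coordinate, which \<open>g\<close> does not see.\<close>

lemma shear_add:
  assumes "indep_of i g"
  shows "shear i (\<lambda>x. g x + h x) = shear i g \<circ> shear i h"
  using assms by (auto simp: fun_eq_iff vec_eq_iff shear_nth indep_of_shear algebra_simps)

lemma shear_0: "shear i (\<lambda>x. 0) = id"
  by (auto simp: fun_eq_iff vec_eq_iff shear_nth)

lemma bij_permutation: "bij f \<Longrightarrow> permutation (f :: 'a::finite \<Rightarrow> 'a)"
  unfolding permutation by simp

lemma bij_shear:
  assumes "indep_of i g"
  shows "bij (shear i g)"
proof (rule o_bij)
  have n: "indep_of i (\<lambda>x. - g x)"
    using assms unfolding indep_of_def by metis
  show "shear i (\<lambda>x. - g x) \<circ> shear i g = id" "shear i g \<circ> shear i (\<lambda>x. - g x) = id"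
    using shear_add[OF assms, of "\<lambda>x. - g x"] shear_add[OF n, of g] by (simp_all add: shear_0)
qed

lemma sign_shear_add:
  fixes g h :: "'k::{field, finite} ^ 'n::finite \<Rightarrow> 'k"
  assumes "indep_of i g" "indep_of i h"
  shows "sign (shear i (\<lambda>x. g x + h x)) = sign (shear i g) * sign (shear i h)"
  using assms by (simp add: shear_add sign_compose bij_permutation bij_shear)

lemma sign_shear_sum:
  fixes f :: "'e \<Rightarrow> 'k::{field, finite} ^ 'n::finite \<Rightarrow> 'k"
  assumes "finite A" "\<And>e. e \<in> A \<Longrightarrow> indep_of i (f e)"
  shows "sign (shear i (\<lambda>x. \<Sum>e\<in>A. f e x)) = (\<Prod>e\<in>A. sign (shear i (f e)))"
  using assms by (induction A rule: finite_induct) (simp_all add: shear_0 sign_shear_add indep_of_sum)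

text \<open>Conjugacy stated without an inverse; \<open>sign t\<close> cancels because it is 1 or
  -1.\<close>

lemma sign_semiconj:
  fixes f g t :: "'a::finite \<Rightarrow> 'a"
  assumes "bij f" "bij g" "bij t" "t \<circ> f = g \<circ> t"
  shows "sign f = sign g"
proof -
  have "sign t * sign f = sign g * sign t"
    using assms by (metis sign_compose bij_permutation)
  then show ?thesis
    by (simp add: sign_def split: if_splits)
qed

lemma sign_mult_self: "sign p * sign p = 1"
  by (simp add: sign_def)

section \<open>Fields with more than two elements\<close>

lemma indep_of_cmult: "indep_of i g \<Longrightarrow> indep_of i (\<lambda>x. c * g x)"
  unfolding indep_of_def by metis

lemma sign_shear_scale:
  fixes g :: "'k::{field, finite} ^ 'n::finite \<Rightarrow> 'k"
  assumes "indep_of i g" "c \<noteq> 0"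
  shows "sign (shear i (\<lambda>x. c * g x)) = sign (shear i g)"
proof (rule sign_semiconj[symmetric])
  \<comment> \<open>The factor \<open>d\<close> is kept as a parameter so that
    \<open>?t (inverse c)\<close> can serve as the inverse of \<open>?t c\<close>.\<close>
  let ?t = "\<lambda>d (x :: 'k ^ 'n). \<chi> j. if j = i then d * x $ i else x $ j"
  show "bij (?t c)"
    by (rule o_bij[of "?t (inverse c)"]) (use assms(2) in \<open>auto simp: fun_eq_iff vec_eq_iff\<close>)
  have "g (?t c x) = g x" for x
    by (rule indep_ofD[OF assms(1)]) simp
  then show "?t c \<circ> shear i g = shear i (\<lambda>x. c * g x) \<circ> ?t c"
    by (auto simp: fun_eq_iff vec_eq_iff shear_nth algebra_simps)
qed (use assms in \<open>auto intro!: bij_shear indep_of_cmult\<close>)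

lemma sign_shear_eq_1:
  fixes g :: "'k::{field, finite} ^ 'n::finite \<Rightarrow> 'k"
  assumes "indep_of i g" "CARD('k) > 2"
  shows "sign (shear i g) = 1"
proof -
  have "card {0, - 1 :: 'k} \<le> 2"
    by (simp add: card_insert_if)
  with assms(2) have "{0, - 1 :: 'k} \<noteq> UNIV"
    by (metis not_le)
  then obtain c :: 'k where c: "c \<noteq> 0" "c \<noteq> - 1"
    by blast
  then have "1 + c \<noteq> 0"
    by (metis add_eq_0_iff)
  then have "sign (shear i g) = sign (shear i (\<lambda>x. (1 + c) * g x))"
    by (rule sign_shear_scale[OF assms(1), symmetric])
  also have "\<dots> = sign (shear i (\<lambda>x. g x + c * g x))"
    by (simp add: algebra_simps)
  also have "\<dots> = sign (shear i g) * sign (shear i g)"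
    using assms(1) c(1) by (simp add: sign_shear_add indep_of_cmult sign_shear_scale)
  finally show ?thesis
    by (simp add: sign_mult_self)
qed

section \<open>The field with two elements\<close>

lemma two_element_field:
  fixes c :: "'k::{field, finite}"
  assumes "CARD('k) = 2"
  shows "c = 0 \<or> c = 1" "(1 :: 'k) + 1 = 0"
proof -
  have "{0, 1 :: 'k} = UNIV"
    by (rule card_subset_eq) (use assms in auto)
  then have *: "d = 0 \<or> d = 1" for d :: 'k
    by blast
  show "c = 0 \<or> c = 1"
    by (rule *)
  show "(1 :: 'k) + 1 = 0"
    using *[of "1 + 1"] by (metis add_cancel_right_right one_neq_zero)
qed

lemma sign_shear_missing_variable:
  fixes g :: "'k::{field, finite} ^ 'n::finite \<Rightarrow> 'k"
  assumes k: "CARD('k) = 2" and i: "indep_of i g" and j: "indep_of j g" and ij: "i \<noteq> j"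
  shows "sign (shear i g) = 1"
proof -
  have two: "z + z = 0" for z :: 'k
    using two_element_field(2)[OF k] by (metis mult.right_neutral mult_zero_right distrib_left)
  \<comment> \<open>The factors \<open>x $ j\<close> and \<open>1 + x $ j\<close> are the indicators
    of \<open>x $ j = 1\<close> and \<open>x $ j = 0\<close>, so \<open>g\<close> is split along
    these two hyperplanes, which \<open>?t\<close> exchanges.\<close>
  let ?g0 = "\<lambda>x. g x * x $ j" and ?g1 = "\<lambda>x. g x * (1 + x $ j)" and ?t = "shear j (\<lambda>x. 1)"
  have ind: "indep_of i ?g0" "indep_of i ?g1"
    using i ij unfolding indep_of_def by metis+
  have one: "indep_of j (\<lambda>x :: 'k ^ 'n. 1 :: 'k)"
    by (simp add: indep_of_def)
  have g: "g x = ?g0 x + ?g1 x" for x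
    using two[of "g x * x $ j"] by (simp add: algebra_simps flip: add.assoc)
  have flip: "1 + (z + 1) = z" for z :: 'k
    using two[of 1] by (simp add: algebra_simps)
  \<comment> \<open>Since \<open>g\<close> is independent of \<open>j\<close>, \<open>?t\<close>
    leaves it fixed; by \<open>flip\<close> it turns the factor \<open>1 + x $ j\<close> of
    \<open>?g1\<close> into \<open>x $ j\<close>.\<close>
  have "?t \<circ> shear i ?g0 = shear i ?g1 \<circ> ?t"
    using ij by (auto simp: fun_eq_iff vec_eq_iff shear_nth indep_of_shear[OF j] flip)
  then have "sign (shear i ?g0) = sign (shear i ?g1)"
    by (intro sign_semiconj[where t = ?t] bij_shear ind one)
  moreover have "sign (shear i g) = sign (shear i ?g0) * sign (shear i ?g1)"
    by (subst sign_shear_add[OF ind, symmetric]) (simp flip: g)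
  ultimately show ?thesis
    by (simp add: sign_mult_self)
qed

text \<open>The function is the indicator of a single line in direction \<open>i\<close>. That line
  has just two points, which the shear swaps.\<close>

lemma sign_shear_indicator:
  assumes k: "CARD('k::{field, finite}) = 2"
  shows "sign (shear i (\<lambda>x :: 'k ^ 'n::finite. if \<forall>j. j \<noteq> i \<longrightarrow> x $ j = 1 then 1 else 0)) = - 1"
    (is "sign (shear i ?g) = _")
proof -
  let ?u = "(\<chi> j. if j = i then 0 else 1) :: 'k ^ 'n" and ?v = "1 :: 'k ^ 'n"
  have "shear i ?g x = Transposition.transpose ?u ?v x" for x
  proof (cases "\<forall>j. j \<noteq> i \<longrightarrow> x $ j = 1")
    case True
    then have "x = ?u \<or> x = ?v"
      using two_element_field(1)[OF k, of "x $ i"] by (auto simp: vec_eq_iff)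
    moreover have "shear i ?g ?u = ?v" "shear i ?g ?v = ?u"
      using two_element_field(2)[OF k] by (auto simp: vec_eq_iff shear_nth)
    ultimately show ?thesis
      by auto
  next
    case False
    then have "x \<noteq> ?u" "x \<noteq> ?v" "?g x = 0"
      by auto
    then show ?thesis
      using False by (auto simp: vec_eq_iff shear_nth transpose_def)
  qed
  then have "shear i ?g = Transposition.transpose ?u ?v"
    by (rule ext)
  moreover have "?u \<noteq> ?v"
    by (auto simp: vec_eq_iff)
  ultimately show ?thesis
    by (simp add: sign_swap_id)
qed

lemma indep_of_monomial:
  assumes "Poly_Mapping.lookup e i = 0"
  shows "indep_of i (\<lambda>x :: 'k::comm_ring_1 ^ 'n::finite. \<Prod>j\<in>UNIV. x $ j ^ Poly_Mapping.lookup e j)"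
  unfolding indep_of_def
proof (intro allI impI prod.cong refl)
  fix x y :: "'k ^ 'n" and j
  assume "\<forall>j. j \<noteq> i \<longrightarrow> x $ j = y $ j"
  then show "x $ j ^ Poly_Mapping.lookup e j = y $ j ^ Poly_Mapping.lookup e j"
    using assms by (cases "j = i") auto
qed

text \<open>Positive powers act trivially on 0 and 1, so a monomial containing every variable other
  than the \<open>i\<close>-th is the indicator of the previous case. In dimension one this is the
  constant monomial.\<close>

lemma sign_shear_monomial:
  assumes k: "CARD('k::{field, finite}) = 2" and i: "Poly_Mapping.lookup e i = 0"
  shows "sign (shear i (\<lambda>x :: 'k ^ 'n::finite. \<Prod>j\<in>UNIV. x $ j ^ Poly_Mapping.lookup e j))
    = (if \<forall>j. j \<noteq> i \<longrightarrow> Poly_Mapping.lookup e j \<ge> 1 then - 1 else 1)"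
proof (cases "\<forall>j. j \<noteq> i \<longrightarrow> Poly_Mapping.lookup e j \<ge> 1")
  case True
  have "(\<Prod>j\<in>UNIV. x $ j ^ Poly_Mapping.lookup e j) = (if \<forall>j. j \<noteq> i \<longrightarrow> x $ j = 1 then 1 else 0)"
    for x :: "'k ^ 'n"
  proof (cases "\<forall>j. j \<noteq> i \<longrightarrow> x $ j = 1")
    case all: True
    \<comment> \<open>At \<open>j = i\<close> the factor is \<open>x $ i ^ 0 = 1\<close>, even if
      \<open>x $ i = 0\<close>.\<close>
    then have "x $ j ^ Poly_Mapping.lookup e j = 1" for j
      using i by (cases "j = i") auto
    with all show ?thesis by simp
  next
    case False
    then obtain j where "j \<noteq> i" "x $ j \<noteq> 1" by blast
    then have "x $ j ^ Poly_Mapping.lookup e j = 0"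
      using True two_element_field(1)[OF k, of "x $ j"] by (auto simp: power_0_left Suc_le_eq)
    with False show ?thesis
      by (auto intro!: prod_zero bexI[of _ j])
  qed
  with True show ?thesis
    by (simp add: sign_shear_indicator[OF k])
next
  case False
  then obtain j where "j \<noteq> i" "Poly_Mapping.lookup e j = 0"
    by (auto simp: not_le)
  with i have "sign (shear i (\<lambda>x :: 'k ^ 'n. \<Prod>j\<in>UNIV. x $ j ^ Poly_Mapping.lookup e j)) = 1"
    by (intro sign_shear_missing_variable[OF k, of i _ j] indep_of_monomial) auto
  with False show ?thesis by auto
qed

text \<open>Each key of \<open>a\<close> contributes its own sign by \<open>sign_shear_sum\<close>.
  Distinct monomials inducing the same function are thus counted separately, as in
  \<open>full_monomial_count\<close>.\<close>

lemma sign_shear_polynomial: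
  fixes a :: "('n::finite, 'k::{field, finite}) mpoly"
  assumes k: "CARD('k) = 2" and a: "a \<in> polys_in (UNIV - {i})"
  shows "sign (shear i (\<lambda>x. mpoly_eval id (($) x) a)) = (- 1) ^ full_monomial_count i a"
proof -
  have i: "Poly_Mapping.lookup e i = 0" if "e \<in> Poly_Mapping.keys a" for e
    using a that by (auto simp: polys_in_def simp flip: not_in_keys_iff_lookup_eq_zero)
  have "Poly_Mapping.lookup a e = 1" if "e \<in> Poly_Mapping.keys a" for e
    using two_element_field(1)[OF k, of "Poly_Mapping.lookup a e"] that by (auto simp: in_keys_iff)
  then have "mpoly_eval id (($) x) a
      = (\<Sum>e\<in>Poly_Mapping.keys a. \<Prod>j\<in>UNIV. x $ j ^ Poly_Mapping.lookup e j)" for x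
    by (simp add: mpoly_eval_def)
  then have "sign (shear i (\<lambda>x. mpoly_eval id (($) x) a))
      = (\<Prod>e\<in>Poly_Mapping.keys a.
          if \<forall>j. j \<noteq> i \<longrightarrow> Poly_Mapping.lookup e j \<ge> 1 then - 1 else 1)"
    by (simp add: sign_shear_sum indep_of_monomial i sign_shear_monomial[OF k] cong: prod.cong)
  also have "\<dots> = (\<Prod>e \<in> {e \<in> Poly_Mapping.keys a. \<forall>j. j \<noteq> i \<longrightarrow> Poly_Mapping.lookup e j \<ge> 1}. - 1)"
    by (rule prod.inter_filter[symmetric]) simp
  also have "\<dots> = (- 1) ^ full_monomial_count i a"
    using i by (simp add: full_monomial_count_def cong: conj_cong)
  finally show ?thesis .
qed

theorem theorem1:
  fixes p m q :: nat
    and i :: "'n::finite"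
    and a :: "('n, 'k::{field, finite}) mpoly"
  assumes "prime p" and "m \<ge> 1" and "q = p ^ m" and "CARD('k) = q"
    and "a \<in> polys_in (UNIV - {i})"
  shows "(odd q \<or> q = 2 ^ m \<and> m \<ge> 2 \<longrightarrow>
            induced_map (elementary i a) \<in> Alt UNIV \<and> sign (induced_map (elementary i a)) = 1)
       \<and> (q = 2 \<longrightarrow>
            sign (induced_map (elementary i a)) = (- 1) ^ full_monomial_count i a)"
\<comment> \<open>The pattern in \<open>conjI\<close> splits only the outer conjunction and leaves
  the conclusion about \<open>Alt\<close> and \<open>sign\<close> in one piece.\<close>
proof (intro conjI[of "_ \<longrightarrow> _"] impI)
  let ?g = "\<lambda>x :: 'k ^ 'n. mpoly_eval id (($) x) a"
  have eq: "induced_map (elementary i a) = shear i ?g"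
    by (simp add: fun_eq_iff induced_map_elementary shear_def)
  {
    assume q: "odd q \<or> q = 2 ^ m \<and> m \<ge> 2"
    \<comment> \<open>The distinct elements 0 and 1 give \<open>q \<ge> 2\<close>; both alternatives
      in \<open>q\<close> then exclude \<open>q = 2\<close>.\<close>
    have "card {0, 1 :: 'k} \<le> CARD('k)"
      by (rule card_mono) auto
    then have "q \<ge> 2"
      using assms(4) by simp
    moreover have "(2 :: nat) ^ m > 2" if "m \<ge> 2"
      using power_strict_increasing[of 1 m "2 :: nat"] that by simp
    ultimately have "CARD('k) > 2"
      using q assms(4) by (cases "q = 2") auto
    moreover have "indep_of i ?g"
      unfolding indep_of_def using mpoly_eval_cong[OF assms(5)] by auto
    ultimately have "sign (shear i ?g) = 1"
      by (intro sign_shear_eq_1)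
    then show "induced_map (elementary i a) \<in> Alt UNIV \<and> sign (induced_map (elementary i a)) = 1"
      using induced_map_elementary_permutes[OF assms(5)]
      by (simp add: Alt_def eq sign_def split: if_splits)
  }
  show "sign (induced_map (elementary i a)) = (- 1) ^ full_monomial_count i a" if "q = 2"
    using sign_shear_polynomial[OF _ assms(5)] assms(4) that by (simp add: eq)
qed

end
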